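(* For every positive integer $n$ there exists a finite set of diameter $1$ in $\mathbb{E}^n$ which cannot be covered by $$(2/\sqrt{3}-o(1))^{n}$$ balls of diameter $1$, where $o(1)$ denotes a quantity depending only on $n$ that tends to $0$ as $n\to\infty$.
   Context: $\mathbb{E}^n$ is the $n$-dimensional Euclidean space. Balls are closed Euclidean balls in $\mathbb{E}^n$ (a ball of diameter $1$ has radius $1/2$), with arbitrary centers. "Cannot be covered by $M$ balls" for a real number $M$ means that the set is not contained in the union of any collection of at most $M$ such balls. *)

theory Defs
  imports "HOL-Analysis.Analysis"
begin

text \<open>
  The dimension \<open>n\<close> has to be a term, since the error term is chosen uniformly
  before \<open>n\<close>. So the points of \<open>n\<close>-dimensional Euclidean space are taken to be the elements of
  \<open>topspace (Euclidean_space n)\<close>, i.e. the sequences \<open>x :: nat \<Rightarrow> real\<close> with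
  \<open>x i = 0\<close> for all \<open>i \<ge> n\<close>. The library only gives this space a topology.
\<close>

definition edist :: "nat \<Rightarrow> (nat \<Rightarrow> real) \<Rightarrow> (nat \<Rightarrow> real) \<Rightarrow> real" where
  "edist n x y = L2_set (\<lambda>i. x i - y i) {..<n}"

lemma Metric_space_edist: "Metric_space (topspace (Euclidean_space n)) (edist n)"
proof
  fix x y z :: "nat \<Rightarrow> real"
  show "0 \<le> edist n x y"
    by (simp add: edist_def L2_set_nonneg)
  show "edist n x y = edist n y x"
    by (simp add: edist_def L2_set_def power2_commute)
  show "edist n x y = 0 \<longleftrightarrow> x = y"
    if "x \<in> topspace (Euclidean_space n)" "y \<in> topspace (Euclidean_space n)"
  proof
    assume "edist n x y = 0"
    then have "x i = y i" if "i < n" for i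
      using that by (simp add: edist_def L2_set_eq_0_iff)
    moreover have "x i = y i" if "\<not> i < n" for i
      using \<open>x \<in> _\<close> \<open>y \<in> _\<close> that by (simp add: topspace_Euclidean_space)
    ultimately show "x = y" by blast
  qed (simp add: edist_def L2_set_def)
  show "edist n x z \<le> edist n x y + edist n y z"
    using L2_set_triangle_ineq[of "\<lambda>i. x i - y i" "\<lambda>i. y i - z i" "{..<n}"]
    by (simp add: edist_def)
qed

definition ecball :: "nat \<Rightarrow> (nat \<Rightarrow> real) \<Rightarrow> real \<Rightarrow> (nat \<Rightarrow> real) set" where
  "ecball n = Metric_space.mcball (topspace (Euclidean_space n)) (edist n)"

lemma ecball_eq:
  assumes "c \<in> topspace (Euclidean_space n)"
  shows "ecball n c r = {x \<in> topspace (Euclidean_space n). edist n c x \<le> r}"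
  using assms by (auto simp: ecball_def Metric_space.mcball_def[OF Metric_space_edist])

text \<open>As for \<^const>\<open>diameter\<close>, the value is only meaningful for bounded sets.\<close>

definition ediameter :: "nat \<Rightarrow> (nat \<Rightarrow> real) set \<Rightarrow> real" where
  "ediameter n S = (if S = {} then 0 else SUP (x, y)\<in>S \<times> S. edist n x y)"

definition is_ball_of_diameter :: "nat \<Rightarrow> real \<Rightarrow> (nat \<Rightarrow> real) set \<Rightarrow> bool" where
  "is_ball_of_diameter n d B \<longleftrightarrow> (\<exists>c \<in> topspace (Euclidean_space n). B = ecball n c (d / 2))"

definition coverable_by_balls :: "nat \<Rightarrow> real \<Rightarrow> real \<Rightarrow> (nat \<Rightarrow> real) set \<Rightarrow> bool" where
  "coverable_by_balls n d M S \<longleftrightarrow>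
    (\<exists>\<B>. finite \<B> \<and> real (card \<B>) \<le> M \<and> (\<forall>B\<in>\<B>. is_ball_of_diameter n d B) \<and> S \<subseteq> \<Union>\<B>)"

end

theory Submission
  imports Defs
begin

text \<open>
  Let \<open>X\<close> be the ball of radius \<open>1/\<surd>3\<close> about the origin. By scaling, a ball of radius \<open>1/2\<close>
  contains at most the fraction \<open>(\<surd>3/2)^n\<close> of the volume of \<open>X\<close>, so \<open>X\<close> itself needs at least
  \<open>(2/\<surd>3)^n\<close> balls of diameter \<open>1\<close>. Its diameter is \<open>2/\<surd>3\<close>, which is too large. The
  reason for the radius \<open>1/\<surd>3\<close> is the balance expressed by \<open>far_points_in_small_ball\<close>:
  for \<open>x\<close> in \<open>X\<close>, the points of \<open>X\<close> at distance more than \<open>1\<close> from \<open>x\<close> lie in the ball of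
  radius \<open>1/2\<close> about \<open>-x/2\<close>, so they too make up at most the fraction \<open>(\<surd>3/2)^n\<close>. Hence about
  \<open>(2/\<surd>3)^n\<close> points can be chosen in \<open>X\<close> one after the other, pairwise at distance at most \<open>1\<close>,
  and each choice can still be made freely in at least half of \<open>X\<close>.

  This freedom is used to defeat all covers at once. Let \<open>m \<le> (2/\<surd>3 - \<delta>)^n\<close>. If the balls are
  enlarged to radius \<open>1/2 + \<eta>\<close>, with \<open>\<eta>\<close> small against \<open>\<delta>\<close>, then it is enough to consider
  centres in an \<open>\<eta>\<close>-net with at most \<open>K^n\<close> points (\<open>exists_net\<close>), that is, at most \<open>K^(n m)\<close>
  candidate covers. The union of the \<open>m\<close> balls of one candidate has at most the fraction \<open>q^n\<close>
  of the volume of \<open>X\<close>, where \<open>q < 1\<close>. By averaging (\<open>exists_point_in_few_sets\<close>), the next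
  point can be chosen such that at most the fraction \<open>2 q^n\<close> of the candidates that cover all earlier
  points cover this point, too (\<open>greedy_independent_set\<close>). With a constant \<open>k\<close> such that
  \<open>q^k K < 1\<close>, no candidate is left after \<open>k m\<close> steps when \<open>n\<close> is large, and the number \<open>k m\<close>
  of points is small enough for the choices to remain possible.

  This gives, for each \<open>\<delta>\<close>, a set that is good for \<open>\<delta>\<close> in every sufficiently large dimension;
  a diagonal choice (\<open>tendsto_diagonal_choice\<close>) turns the constants \<open>\<delta>\<close> into one error term.
\<close>

section \<open>The distance and points that are far apart\<close>

lemma edist_commute: "edist n x y = edist n y x"
  by (simp add: edist_def L2_set_def power2_commute)

lemma edist_self: "edist n x x = 0"
  by (simp add: edist_def L2_set_def)

lemma edist_nonneg: "0 \<le> edist n x y"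
  by (simp add: edist_def L2_set_nonneg)

lemma edist_triangle: "edist n x z \<le> edist n x y + edist n y z"
  using L2_set_triangle_ineq[of "\<lambda>i. x i - y i" "\<lambda>i. y i - z i" "{..<n}"]
  by (simp add: edist_def)

lemma edist_cong:
  assumes "\<And>i. i < n \<Longrightarrow> x i = x' i" "\<And>i. i < n \<Longrightarrow> y i = y' i"
  shows "edist n x y = edist n x' y'"
  unfolding edist_def using assms by (intro L2_set_cong) auto

lemma edist_power2: "(edist n x y)\<^sup>2 = (\<Sum>i<n. (x i - y i)\<^sup>2)"
  unfolding edist_def L2_set_def by (simp add: sum_nonneg)

text \<open>
  This rests on the identity \<open>|y + x/2|^2 = 3/4 |x|^2 + 3/2 |y|^2 - 1/2 |x - y|^2\<close>, whose
  right-hand side is less than \<open>1/4 + 1/2 - 1/2\<close>.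
\<close>

lemma far_points_in_small_ball:
  assumes x: "edist n (\<lambda>_. 0) x \<le> 1 / sqrt 3" and y: "edist n (\<lambda>_. 0) y \<le> 1 / sqrt 3"
    and far: "1 < edist n x y"
  shows "edist n (\<lambda>i. - x i / 2) y \<le> 1 / 2"
proof -
  have sq: "(edist n (\<lambda>_. 0) z)\<^sup>2 \<le> 1 / 3" if "edist n (\<lambda>_. 0) z \<le> 1 / sqrt 3" for z
    using power_mono[OF that edist_nonneg, of 2] by (simp add: power_divide)
  have "(edist n (\<lambda>i. - x i / 2) y)\<^sup>2 = (\<Sum>i<n. 3/4 * (0 - x i)\<^sup>2 + 3/2 * (0 - y i)\<^sup>2 - 1/2 * (x i - y i)\<^sup>2)"
    unfolding edist_power2 by (intro sum.cong) (auto simp: power2_eq_square algebra_simps)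
  also have "\<dots> = 3/4 * (edist n (\<lambda>_. 0) x)\<^sup>2 + 3/2 * (edist n (\<lambda>_. 0) y)\<^sup>2 - 1/2 * (edist n x y)\<^sup>2"
    by (simp add: edist_power2 sum.distrib sum_subtractf sum_distrib_left)
  also have "\<dots> \<le> (1/2)\<^sup>2"
    using sq[OF x] sq[OF y] one_less_power[OF far, of 2] by (simp add: power2_eq_square)
  finally show ?thesis
    by (rule power2_le_imp_le) simp
qed

section \<open>Volume of balls\<close>

text \<open>
  The points of the product measure are \<open>undefined\<close> rather than \<open>0\<close> from coordinate \<open>n\<close> on.
  This is harmless, since \<^const>\<open>edist\<close> only looks at the first \<open>n\<close> coordinates; for the same
  reason the centres of balls may be arbitrary sequences.
\<close>

definition Leb :: "nat \<Rightarrow> (nat \<Rightarrow> real) measure" where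
  "Leb n = (\<Pi>\<^sub>M i\<in>{..<n}. lborel)"

definition vball :: "nat \<Rightarrow> (nat \<Rightarrow> real) \<Rightarrow> real \<Rightarrow> (nat \<Rightarrow> real) set" where
  "vball n c r = {x \<in> space (Leb n). edist n c x \<le> r}"

text \<open>
  The volume of balls about the origin is known for a product of Lebesgue measures. Translation
  invariance carries it over to all centres; it is inherited from the factors because translates of
  boxes are boxes.
\<close>

lemma Leb_translate:
  "distr (Leb n) (Leb n) (\<lambda>x. \<lambda>i\<in>{..<n}. c i + x i) = Leb n"
proof -
  interpret product_sigma_finite "\<lambda>_::nat. lborel :: real measure" ..
  have meas: "(\<lambda>x. \<lambda>i\<in>{..<n}. c i + x i) \<in> measurable (Leb n) (Leb n)"
    unfolding Leb_def by measurable
  show ?thesis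
    unfolding Leb_def
  proof (rule PiM_eqI)
    fix A :: "nat \<Rightarrow> real set" assume A: "\<And>i. i \<in> {..<n} \<Longrightarrow> A i \<in> sets lborel"
    have vim: "(\<lambda>x. c i + x) -` A i \<in> sets lborel" if "i < n" for i
      using measurable_sets[of "\<lambda>x. c i + x" lborel lborel "A i"] A that by simp
    have eq: "(\<lambda>x. \<lambda>i\<in>{..<n}. c i + x i) -` Pi\<^sub>E {..<n} A \<inter> space (\<Pi>\<^sub>M i\<in>{..<n}. lborel)
        = Pi\<^sub>E {..<n} (\<lambda>i. (\<lambda>x. c i + x) -` A i)"
      by (auto simp: space_PiM PiE_iff)
    have one: "emeasure lborel ((\<lambda>x. c i + x) -` A i) = emeasure lborel (A i)" if "i < n" for i
    proof -
      have "emeasure lborel (A i) = emeasure (distr lborel borel (\<lambda>x. c i + x)) (A i)"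
        using lborel_distr_plus[of "c i"] by simp
      also have "\<dots> = emeasure lborel ((\<lambda>x. c i + x) -` A i)"
        using A[of i] that by (subst emeasure_distr) auto
      finally show ?thesis ..
    qed
    show "emeasure (distr (\<Pi>\<^sub>M i\<in>{..<n}. lborel) (\<Pi>\<^sub>M i\<in>{..<n}. lborel)
           (\<lambda>x. \<lambda>i\<in>{..<n}. c i + x i)) (Pi\<^sub>E {..<n} A) = (\<Prod>i<n. emeasure lborel (A i))"
    proof (subst emeasure_distr)
      have "emeasure (\<Pi>\<^sub>M i\<in>{..<n}. lborel) (Pi\<^sub>E {..<n} (\<lambda>i. (\<lambda>x. c i + x) -` A i))
          = (\<Prod>i<n. emeasure lborel ((\<lambda>x. c i + x) -` A i))"
        using vim by (intro emeasure_PiM) auto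
      also have "\<dots> = (\<Prod>i<n. emeasure lborel (A i))"
        using one by (intro prod.cong) auto
      finally show "emeasure (\<Pi>\<^sub>M i\<in>{..<n}. lborel) ((\<lambda>x. \<lambda>i\<in>{..<n}. c i + x i) -` Pi\<^sub>E {..<n} A \<inter>
          space (\<Pi>\<^sub>M i\<in>{..<n}. lborel)) = (\<Prod>i<n. emeasure lborel (A i))"
        by (simp only: eq)
    qed (use meas A in \<open>auto simp: Leb_def intro!: sets_PiM_I_finite\<close>)
  qed simp_all
qed

lemma sets_vball: "vball n c r \<in> sets (Leb n)"
proof -
  have "(\<lambda>x. edist n c x) \<in> borel_measurable (Leb n)"
    unfolding edist_def L2_set_def Leb_def by measurable
  then show ?thesis
    unfolding vball_def by measurable
qed

lemma emeasure_vball: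
  assumes "0 < r"
  shows "emeasure (Leb n) (vball n c r) = ennreal (unit_ball_vol n * r ^ n)"
proof -
  let ?T = "\<lambda>x. \<lambda>i\<in>{..<n}. c i + x i"
  have meas: "?T \<in> measurable (Leb n) (Leb n)"
    unfolding Leb_def by measurable
  have "emeasure (Leb n) (vball n c r) = emeasure (distr (Leb n) (Leb n) ?T) (vball n c r)"
    by (simp only: Leb_translate)
  also have "\<dots> = emeasure (Leb n) (?T -` vball n c r \<inter> space (Leb n))"
    by (rule emeasure_distr[OF meas sets_vball])
  also have "?T -` vball n c r \<inter> space (Leb n) = {f. sqrt (\<Sum>i<n. (f i)\<^sup>2) \<le> r} \<inter> space (Leb n)"
    using measurable_space[OF meas] by (auto simp: vball_def edist_def L2_set_def)
  also have "emeasure (Leb n) \<dots> = ennreal (unit_ball_vol n * r ^ n)"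
    using emeasure_cball_aux[of "{..<n}" r] assms by (simp add: Leb_def)
  finally show ?thesis .
qed

lemma vball_fmeasurable: "0 < r \<Longrightarrow> vball n c r \<in> fmeasurable (Leb n)"
  by (intro fmeasurableI sets_vball) (simp add: emeasure_vball)

lemma measure_vball: "0 < r \<Longrightarrow> measure (Leb n) (vball n c r) = unit_ball_vol n * r ^ n"
  by (simp add: measure_def emeasure_vball)

section \<open>Greedy choice of points that lie in few sets\<close>

text \<open>
  The mean over \<open>A\<close> of the number of sets that contain a point is at most \<open>\<theta>\<close> times the number
  of all sets, and the minimum is at most the mean.
\<close>

lemma exists_point_in_few_sets:
  fixes U :: "'i \<Rightarrow> 'a set"
  assumes I: "finite I" and A: "A \<in> fmeasurable M" "0 < measure M A"
    and U: "\<And>i. i \<in> I \<Longrightarrow> U i \<in> fmeasurable M"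
    and le: "\<And>i. i \<in> I \<Longrightarrow> measure M (U i) \<le> \<theta> * measure M A"
  shows "\<exists>x\<in>A. real (card {i\<in>I. x \<in> U i}) \<le> \<theta> * real (card I)"
proof -
  have "A \<noteq> {}" using A(2) by auto
  then obtain a where a: "a \<in> A" by blast
  obtain x where x: "x \<in> A" and
    min: "\<And>y. y \<in> A \<Longrightarrow> card {i\<in>I. x \<in> U i} \<le> card {i\<in>I. y \<in> U i}"
    using ex_has_least_nat[of "\<lambda>x. x \<in> A" a "\<lambda>x. card {i\<in>I. x \<in> U i}"] a by blast
  let ?k = "card {i\<in>I. x \<in> U i}"
  have int: "integrable M (indicat_real B)" if "B \<in> fmeasurable M" for B
    using that fmeasurableD[OF that] by (auto simp: fmeasurable_def)
  have "real ?k * measure M A = (\<integral>y. real ?k * indicat_real A y \<partial>M)"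
    using A fmeasurableD[OF A(1)] sets.sets_into_space by (simp add: Int_absorb2)
  also have "\<dots> \<le> (\<integral>y. (\<Sum>i\<in>I. indicat_real (U i) y) \<partial>M)"
  proof (rule integral_mono)
    show "integrable M (\<lambda>y. real ?k * indicat_real A y)"
      using int[OF A(1)] by simp
    show "integrable M (\<lambda>y. \<Sum>i\<in>I. indicat_real (U i) y)"
      using int U by (intro Bochner_Integration.integrable_sum) auto
    fix y
    have "(\<Sum>i\<in>I. indicat_real (U i) y) = real (card {i\<in>I. y \<in> U i})"
      using I by (simp add: indicator_def sum.If_cases Int_def)
    then show "real ?k * indicat_real A y \<le> (\<Sum>i\<in>I. indicat_real (U i) y)"
      using min[of y] by (auto simp: indicator_def)
  qed
  also have "\<dots> = (\<Sum>i\<in>I. measure M (U i))"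
    using int U fmeasurableD[OF U] sets.sets_into_space
    by (subst Bochner_Integration.integral_sum) (auto intro!: sum.cong simp: Int_absorb2)
  also have "\<dots> \<le> (\<Sum>i\<in>I. \<theta> * measure M A)"
    by (intro sum_mono le)
  also have "\<dots> = \<theta> * real (card I) * measure M A"
    by simp
  finally show ?thesis
    using x A(2) by auto
qed

text \<open>
  As long as there are at most \<open>1/(2p)\<close> points, the sets \<open>E x\<close> of the points chosen so far
  leave at least half of \<open>X\<close>. Relative to this half, each \<open>U i\<close> has density at most \<open>2 \<alpha>\<close>, so by
  averaging some admissible point reduces the number of sets \<open>U i\<close> that contain all points by the
  factor \<open>2 \<alpha>\<close>. The start set \<open>S0\<close> is there to prescribe some of the points.
\<close>

lemma greedy_independent_set:
  fixes U :: "'i \<Rightarrow> 'a set" and E :: "'a \<Rightarrow> 'a set"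
  assumes I: "finite I" and X: "X \<in> fmeasurable M" "0 < measure M X"
    and U: "\<And>i. i \<in> I \<Longrightarrow> U i \<in> fmeasurable M" "\<And>i. i \<in> I \<Longrightarrow> measure M (U i) \<le> \<alpha> * measure M X"
    and sym: "\<And>x y. far x y \<Longrightarrow> far y x" and irrefl: "\<And>x. \<not> far x x"
    and E: "\<And>x. x \<in> X \<Longrightarrow> E x \<in> fmeasurable M" "\<And>x. x \<in> X \<Longrightarrow> measure M (E x) \<le> p * measure M X"
      "\<And>x y. x \<in> X \<Longrightarrow> y \<in> X \<Longrightarrow> far x y \<Longrightarrow> y \<in> E x"
    and p: "0 \<le> p" and \<alpha>: "0 \<le> \<alpha>"
    and S0: "finite S0" "S0 \<subseteq> X" "\<And>x y. x \<in> S0 \<Longrightarrow> y \<in> S0 \<Longrightarrow> \<not> far x y"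
    and t: "real (card S0 + t) * p \<le> 1 / 2"
  shows "\<exists>S. finite S \<and> S0 \<subseteq> S \<and> S \<subseteq> X \<and> card S \<le> card S0 + t \<and> (\<forall>x\<in>S. \<forall>y\<in>S. \<not> far x y) \<and>
    real (card {i\<in>I. S \<subseteq> U i}) \<le> (2 * \<alpha>) ^ t * real (card I)"
  using t
proof (induction t)
  case 0
  have "card {i\<in>I. S0 \<subseteq> U i} \<le> card I"
    using I by (intro card_mono) auto
  then show ?case
    using S0 by (intro exI[of _ S0]) auto
next
  case (Suc t)
  have "real (card S0 + t) * p \<le> real (card S0 + Suc t) * p"
    using p by (intro mult_right_mono) auto
  with Suc obtain S where S: "finite S" "S0 \<subseteq> S" "S \<subseteq> X" "card S \<le> card S0 + t"
    and near: "\<And>x y. x \<in> S \<Longrightarrow> y \<in> S \<Longrightarrow> \<not> far x y"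
    and few: "real (card {i\<in>I. S \<subseteq> U i}) \<le> (2 * \<alpha>) ^ t * real (card I)"
    by force
  define A where "A = X - (\<Union>x\<in>S. E x)"
  have Em: "(\<Union>x\<in>S. E x) \<in> fmeasurable M"
    using S E by (intro fmeasurable.finite_UN) auto
  have A: "A \<in> fmeasurable M"
    unfolding A_def using X Em by auto
  have "measure M (\<Union>x\<in>S. E x) \<le> (\<Sum>x\<in>S. measure M (E x))"
    using S E by (intro measure_UNION_le) (auto intro: fmeasurableD)
  also have "\<dots> \<le> (\<Sum>x\<in>S. p * measure M X)"
    using S E by (intro sum_mono) auto
  also have "\<dots> = (real (card S) * p) * measure M X"
    by simp
  also have "\<dots> \<le> (real (card S0 + Suc t) * p) * measure M X"
    using S p by (intro mult_right_mono) auto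
  also have "\<dots> \<le> 1 / 2 * measure M X"
    using Suc.prems by (intro mult_right_mono) auto
  finally have Ele: "measure M (\<Union>x\<in>S. E x) \<le> 1 / 2 * measure M X" .
  have "measure M X \<le> measure M (A \<union> (\<Union>x\<in>S. E x))"
    using X A Em by (intro measure_mono_fmeasurable) (auto simp: A_def fmeasurableD)
  also have "\<dots> \<le> measure M A + measure M (\<Union>x\<in>S. E x)"
    using A Em by (intro measure_Un_le) (auto simp: fmeasurableD)
  finally have half: "measure M X \<le> 2 * measure M A"
    using Ele by linarith
  let ?J = "{i\<in>I. S \<subseteq> U i}"
  (* averaging over the admissible points, for the sets that contain all of S *)
  have "\<exists>x\<in>A. real (card {i\<in>?J. x \<in> U i}) \<le> (2 * \<alpha>) * real (card ?J)"
  proof (rule exists_point_in_few_sets)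
    fix i assume i: "i \<in> ?J"
    have "\<alpha> * measure M X \<le> \<alpha> * (2 * measure M A)"
      using half \<alpha> by (intro mult_left_mono)
    then show "measure M (U i) \<le> 2 * \<alpha> * measure M A"
      using U(2)[of i] i by simp
  qed (use I A U X half in auto)
  then obtain x where x: "x \<in> A" and step: "real (card {i\<in>?J. x \<in> U i}) \<le> (2 * \<alpha>) * real (card ?J)"
    by blast
  have "{i\<in>I. insert x S \<subseteq> U i} = {i\<in>?J. x \<in> U i}"
    by auto
  then have "real (card {i\<in>I. insert x S \<subseteq> U i}) \<le> (2 * \<alpha>) * ((2 * \<alpha>) ^ t * real (card I))"
    using step mult_left_mono[OF few, of "2 * \<alpha>"] \<alpha> by simp
  moreover have "\<not> far y z" if "y \<in> insert x S" "z \<in> insert x S" for y z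
  proof -
    have "\<not> far s x" if "s \<in> S" for s
      using E(3)[of s x] that S x by (auto simp: A_def)
    with that near sym irrefl show ?thesis by blast
  qed
  moreover have "card (insert x S) \<le> card S0 + Suc t"
    using S by (simp add: card_insert_if)
  ultimately show ?case
    using S x by (intro exI[of _ "insert x S"]) (auto simp: A_def)
qed

section \<open>Nets of exponential size\<close>

text \<open>
  The balls of radius \<open>\<eta>/2\<close> about the points of \<open>P\<close> are disjoint and contained in the ball of
  radius \<open>D + \<eta>/2\<close>; compare volumes.
\<close>

lemma separated_set_card_le:
  assumes "0 < D" "0 < \<eta>" and P: "finite P" "P \<subseteq> vball n (\<lambda>_. 0) D"
    and sep: "\<And>x y. x \<in> P \<Longrightarrow> y \<in> P \<Longrightarrow> x \<noteq> y \<Longrightarrow> \<eta> < edist n x y"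
  shows "real (card P) \<le> ((2 * D + \<eta>) / \<eta>) ^ n"
proof -
  have disj: "disjoint_family_on (\<lambda>x. vball n x (\<eta> / 2)) P"
    unfolding disjoint_family_on_def
  proof (intro ballI impI)
    fix x y assume xy: "x \<in> P" "y \<in> P" "x \<noteq> y"
    show "vball n x (\<eta> / 2) \<inter> vball n y (\<eta> / 2) = {}"
    proof (rule equals0I)
      fix z assume "z \<in> vball n x (\<eta> / 2) \<inter> vball n y (\<eta> / 2)"
      then show False
        using sep[OF xy] edist_triangle[of n x y z] edist_commute[of n y z]
        by (simp add: vball_def)
    qed
  qed
  have "real (card P) * (unit_ball_vol n * (\<eta> / 2) ^ n) = (\<Sum>x\<in>P. measure (Leb n) (vball n x (\<eta> / 2)))"
    using assms by (simp add: measure_vball)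
  also have "\<dots> = measure (Leb n) (\<Union>x\<in>P. vball n x (\<eta> / 2))"
    using P(1) disj \<open>0 < \<eta>\<close> by (subst measure_finite_Union)
      (simp_all add: sets_vball emeasure_vball image_subset_iff)
  also have "\<dots> \<le> measure (Leb n) (vball n (\<lambda>_. 0) (D + \<eta> / 2))"
  proof (rule measure_mono_fmeasurable)
    show "(\<Union>x\<in>P. vball n x (\<eta> / 2)) \<subseteq> vball n (\<lambda>_. 0) (D + \<eta> / 2)"
    proof
      fix y assume "y \<in> (\<Union>x\<in>P. vball n x (\<eta> / 2))"
      then obtain x where x: "x \<in> P" "y \<in> space (Leb n)" "edist n x y \<le> \<eta> / 2"
        by (auto simp: vball_def)
      then have "edist n (\<lambda>_. 0) x \<le> D"
        using P by (auto simp: vball_def)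
      then show "y \<in> vball n (\<lambda>_. 0) (D + \<eta> / 2)"
        using x edist_triangle[of n "\<lambda>_. 0" y x] by (simp add: vball_def)
    qed
    show "(\<Union>x\<in>P. vball n x (\<eta> / 2)) \<in> sets (Leb n)"
      using P(1) by (intro sets.finite_UN sets_vball)
    show "vball n (\<lambda>_. 0) (D + \<eta> / 2) \<in> fmeasurable (Leb n)"
      using assms(1,2) by (intro vball_fmeasurable) simp
  qed
  also have "\<dots> = unit_ball_vol n * (D + \<eta> / 2) ^ n"
    using assms by (simp add: measure_vball)
  finally have "unit_ball_vol n * (real (card P) * (\<eta> / 2) ^ n) \<le> unit_ball_vol n * (D + \<eta> / 2) ^ n"
    by (simp add: mult_ac)
  then have "real (card P) * (\<eta> / 2) ^ n \<le> (D + \<eta> / 2) ^ n"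
    by (simp add: mult_le_cancel_left_pos)
  then have "real (card P) \<le> (D + \<eta> / 2) ^ n / (\<eta> / 2) ^ n"
    using assms by (simp add: pos_le_divide_eq)
  also have "\<dots> = ((D + \<eta> / 2) / (\<eta> / 2)) ^ n"
    by (rule power_divide[symmetric])
  also have "(D + \<eta> / 2) / (\<eta> / 2) = (2 * D + \<eta>) / \<eta>"
    using assms by (simp add: field_simps)
  finally show ?thesis .
qed

text \<open>
  A separated set of maximal size is a net. What matters for the counting of covers is that the size
  is bounded by a constant, depending on \<open>D\<close> and \<open>\<eta>\<close> alone, to the power \<open>n\<close>.
\<close>

lemma exists_net:
  assumes "0 < D" "0 < \<eta>"
  obtains C where "finite C" "C \<noteq> {}" "real (card C) \<le> ((2 * D + \<eta>) / \<eta>) ^ n"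
    "\<And>c. edist n (\<lambda>_. 0) c \<le> D \<Longrightarrow> \<exists>c'\<in>C. edist n c' c \<le> \<eta>"
proof -
  define sep where "sep P \<longleftrightarrow> finite P \<and> P \<subseteq> vball n (\<lambda>_. 0) D \<and>
    (\<forall>x\<in>P. \<forall>y\<in>P. x \<noteq> y \<longrightarrow> \<eta> < edist n x y)" for P
  have card: "real (card P) \<le> ((2 * D + \<eta>) / \<eta>) ^ n" if "sep P" for P
    using that assms by (intro separated_set_card_le) (auto simp: sep_def)
  have bound: "\<forall>P. sep P \<longrightarrow> card P < Suc (nat \<lceil>((2 * D + \<eta>) / \<eta>) ^ n\<rceil>)"
    using card by (smt (verit, best) less_Suc_eq_le of_nat_ceiling of_nat_le_iff)
  have "sep {}" by (simp add: sep_def)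
  then obtain C where C: "sep C" "\<And>P. sep P \<Longrightarrow> card P \<le> card C"
    using ex_has_greatest_nat[OF _ bound] by blast
  have net: "\<exists>c'\<in>C. edist n c' c \<le> \<eta>" if c: "edist n (\<lambda>_. 0) c \<le> D" for c
  proof (rule ccontr)
    assume far: "\<not> ?thesis"
    (* c with its irrelevant coordinates changed so that it is a point of the measure space *)
    define d where "d = restrict c {..<n}"
    have d: "edist n x d = edist n x c" for x
      by (rule edist_cong) (auto simp: d_def)
    have "d \<in> vball n (\<lambda>_. 0) D"
      using c by (simp add: vball_def d) (simp add: d_def Leb_def space_PiM)
    moreover have dC: "\<eta> < edist n x d" "\<eta> < edist n d x" if "x \<in> C" for x
      using far that d edist_commute[of n d x] by force+
    ultimately have "sep (insert d C)"
      using C(1) by (auto simp: sep_def)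
    moreover have "d \<notin> C"
      using dC(1)[of d] assms by (auto simp: edist_self)
    ultimately show False
      using C(2)[of "insert d C"] C(1) by (simp add: sep_def)
  qed
  have "C \<noteq> {}"
    using net[of "\<lambda>_. 0"] assms by (auto simp: edist_self)
  then show ?thesis
    using that[of C] C(1) card[OF C(1)] net by (auto simp: sep_def)
qed

section \<open>Sets of diameter one that are hard to cover\<close>

lemma mem_topspace_Euclidean_space: "x \<in> topspace (Euclidean_space n) \<longleftrightarrow> (\<forall>i\<ge>n. x i = 0)"
  by (auto simp: topspace_Euclidean_space)

lemma ediameter_eqI:
  assumes "a \<in> S" "b \<in> S" "edist n a b = d" "\<And>x y. x \<in> S \<Longrightarrow> y \<in> S \<Longrightarrow> edist n x y \<le> d"
  shows "ediameter n S = d"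
proof -
  have "(SUP (x, y)\<in>S \<times> S. edist n x y) = d"
  proof (rule cSup_eq_maximum)
    show "d \<in> (\<lambda>(x, y). edist n x y) ` (S \<times> S)"
      using assms(1-3) by (intro image_eqI[of _ _ "(a, b)"]) auto
  qed (use assms(4) in auto)
  then show ?thesis
    using assms(1) by (auto simp: ediameter_def)
qed

text \<open>
  The greedy choice in the ball of radius \<open>1/\<surd>3\<close>, with the candidate covers indexed by the
  \<open>m\<close>-tuples of points of the net. Here \<open>p\<close> is the volume of a ball of radius
  \<open>1/2 + \<eta>\<close> relative to that of the ball of radius \<open>1/\<surd>3\<close>, and \<open>t\<close> is the number of greedy
  steps. The start set
  consists of two points at distance exactly \<open>1\<close>, which makes the diameter equal to \<open>1\<close>.
\<close>

lemma diameter_one_set_not_coverable: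
  fixes n m k :: nat and \<eta> :: real
  assumes n: "1 \<le> n" and \<eta>: "0 < \<eta>"
  defines "p \<equiv> (sqrt 3 * (1 / 2 + \<eta>)) ^ n"
  assumes t: "real (t + 2) * p \<le> 1 / 2"
    and few: "(2 * (real m * p)) ^ t * (((4 + \<eta>) / \<eta>) ^ n) ^ m < 1"
  shows "\<exists>S. finite S \<and> S \<subseteq> topspace (Euclidean_space n) \<and> ediameter n S = 1 \<and>
    \<not> coverable_by_balls n 1 (real m) S"
proof -
  define X where "X = vball n (\<lambda>_. 0) (1 / sqrt 3)"
  define V where "V = measure (Leb n) X"
  define far where "far x y \<longleftrightarrow> 1 < edist n x y" for x y
  define E where "E x = vball n (\<lambda>i. - x i / 2) (1 / 2)" for x :: "nat \<Rightarrow> real"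
  have V: "V = unit_ball_vol n * (1 / sqrt 3) ^ n"
    unfolding V_def X_def by (rule measure_vball) simp
  then have Vpos: "0 < V" by simp
  have big: "measure (Leb n) (vball n c (1 / 2 + \<eta>)) = p * V" for c
    using \<eta> by (simp add: measure_vball V p_def power_mult_distrib power_divide)
  have p: "0 \<le> p" using \<eta> by (simp add: p_def)
  obtain C where C: "finite C" "C \<noteq> {}" "real (card C) \<le> ((4 + \<eta>) / \<eta>) ^ n"
    and net: "\<And>c. edist n (\<lambda>_. 0) c \<le> 2 \<Longrightarrow> \<exists>c'\<in>C. edist n c' c \<le> \<eta>"
    using exists_net[of 2 \<eta> n] \<eta> by auto
  define I where "I = Pi\<^sub>E {..<m} (\<lambda>_. C)"
  define U where "U F = (\<Union>j<m. vball n (F j) (1 / 2 + \<eta>))" for F :: "nat \<Rightarrow> nat \<Rightarrow> real"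
  have finI: "finite I" unfolding I_def using C by (intro finite_PiE) auto
  have cardI: "real (card I) \<le> (((4 + \<eta>) / \<eta>) ^ n) ^ m"
    unfolding I_def using C by (simp add: card_PiE power_mono)
  have Um: "U F \<in> fmeasurable (Leb n)" for F
    unfolding U_def using \<eta> by (intro fmeasurable.finite_UN vball_fmeasurable) auto
  have Ule: "measure (Leb n) (U F) \<le> (real m * p) * V" for F
  proof -
    have "measure (Leb n) (U F) \<le> (\<Sum>j<m. measure (Leb n) (vball n (F j) (1 / 2 + \<eta>)))"
      unfolding U_def by (intro measure_UNION_le sets_vball) auto
    then show ?thesis by (simp add: big)
  qed
  have Ele: "measure (Leb n) (E x) \<le> p * V" for x
  proof -
    have "measure (Leb n) (E x) \<le> measure (Leb n) (vball n (\<lambda>i. - x i / 2) (1 / 2 + \<eta>))"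
      unfolding E_def using \<eta>
      by (intro measure_mono_fmeasurable sets_vball vball_fmeasurable) (auto simp: vball_def)
    then show ?thesis by (simp only: big)
  qed
  define e where "e s = restrict (\<lambda>i. if i = 0 then s else 0) {..<n}" for s :: real
  have e_dist: "edist n (e s) (e s') = \<bar>s - s'\<bar>" for s s'
  proof -
    have "(edist n (e s) (e s'))\<^sup>2 = (\<Sum>i<n. if i = 0 then (s - s')\<^sup>2 else 0)"
      unfolding edist_power2 by (intro sum.cong) (auto simp: e_def)
    also have "\<dots> = \<bar>s - s'\<bar>\<^sup>2"
      using n by simp
    finally show ?thesis
      by (rule power2_eq_imp_eq) (simp_all add: edist_nonneg)
  qed
  have e_X: "e s \<in> X" if "\<bar>s\<bar> = 1 / 2" for s
  proof -
    have "edist n (\<lambda>_. 0) (e s) = edist n (e 0) (e s)"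
      by (rule edist_cong) (auto simp: e_def)
    also have "\<dots> = 1 / 2" using that by (simp add: e_dist)
    also have "\<dots> \<le> 1 / sqrt 3"
      using real_sqrt_le_mono[of 3 4] by (simp add: field_simps)
    finally show ?thesis
      by (simp add: X_def vball_def) (simp add: Leb_def space_PiM e_def)
  qed
  let ?S0 = "{e (1 / 2), e (- (1 / 2))}"
  have cardS0: "card ?S0 \<le> 2"
    by (simp add: card_insert_if)
  have "\<exists>S. finite S \<and> ?S0 \<subseteq> S \<and> S \<subseteq> X \<and> card S \<le> card ?S0 + t \<and> (\<forall>x\<in>S. \<forall>y\<in>S. \<not> far x y) \<and>
    real (card {F\<in>I. S \<subseteq> U F}) \<le> (2 * (real m * p)) ^ t * real (card I)"
  proof (rule greedy_independent_set[where M = "Leb n" and E = E and p = p])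
    show "X \<in> fmeasurable (Leb n)"
      unfolding X_def by (rule vball_fmeasurable) simp
    show "E x \<in> fmeasurable (Leb n)" for x
      unfolding E_def by (rule vball_fmeasurable) simp
    show "y \<in> E x" if "x \<in> X" "y \<in> X" "far x y" for x y
      using that far_points_in_small_ball[of n x y] by (auto simp: X_def E_def vball_def far_def)
    show "real (card ?S0 + t) * p \<le> 1 / 2"
      using mult_right_mono[OF _ p, of "real (card ?S0 + t)" "real (t + 2)"] cardS0 t by linarith
    show "\<not> far x y" if "x \<in> ?S0" "y \<in> ?S0" for x y
      using that by (auto simp: far_def e_dist)
    show "far x y \<Longrightarrow> far y x" for x y by (simp add: far_def edist_commute)
    show "\<not> far x x" for x by (simp add: far_def edist_self)
    show "0 < measure (Leb n) X" using Vpos by (simp add: V_def)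
    show "measure (Leb n) (U F) \<le> real m * p * measure (Leb n) X" for F
      using Ule[of F] by (simp add: V_def)
    show "measure (Leb n) (E x) \<le> p * measure (Leb n) X" for x
      using Ele[of x] by (simp add: V_def)
    show "?S0 \<subseteq> X" using e_X by simp
  qed (use finI Um p in simp_all)
  then obtain S where S: "finite S" "?S0 \<subseteq> S" "S \<subseteq> X" "\<And>x y. x \<in> S \<Longrightarrow> y \<in> S \<Longrightarrow> edist n x y \<le> 1"
    and surv: "real (card {F\<in>I. S \<subseteq> U F}) \<le> (2 * (real m * p)) ^ t * real (card I)"
    unfolding far_def not_less by blast
  have "(2 * (real m * p)) ^ t * real (card I) < 1"
    using few mult_left_mono[OF cardI, of "(2 * (real m * p)) ^ t"] p
    by (meson le_less_trans mult_nonneg_nonneg of_nat_0_le_iff zero_le_numeral zero_le_power)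
  with surv have "card {F\<in>I. S \<subseteq> U F} = 0" by linarith
  then have no_cover: "\<not> S \<subseteq> U F" if "F \<in> I" for F
    using finI that by auto

  (* The points found are undefined from coordinate n on; z moves them into the Euclidean space. *)
  define z where "z x = (\<lambda>i. if i < n then x i else 0)" for x :: "nat \<Rightarrow> real"
  have z1: "edist n (z x) y = edist n x y" and z2: "edist n y (z x) = edist n y x" for x y
    by (auto simp: z_def intro!: edist_cong)
  have top: "z ` S \<subseteq> topspace (Euclidean_space n)"
    by (auto simp: mem_topspace_Euclidean_space z_def)
  have diam: "ediameter n (z ` S) = 1"
  proof (rule ediameter_eqI)
    show "z (e (1 / 2)) \<in> z ` S" "z (e (- (1 / 2))) \<in> z ` S"
      using S(2) by auto
    show "edist n (z (e (1 / 2))) (z (e (- (1 / 2)))) = 1"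
      by (simp add: z1 z2 e_dist)
    show "edist n x y \<le> 1" if "x \<in> z ` S" "y \<in> z ` S" for x y
      using that S(4) by (auto simp: z1 z2)
  qed
  have "\<not> coverable_by_balls n 1 (real m) (z ` S)"
  proof
    assume "coverable_by_balls n 1 (real m) (z ` S)"
    then obtain \<B> where \<B>: "finite \<B>" "card \<B> \<le> m" "\<And>B. B \<in> \<B> \<Longrightarrow> is_ball_of_diameter n 1 B"
      "z ` S \<subseteq> \<Union>\<B>"
      unfolding coverable_by_balls_def of_nat_le_iff by blast
    obtain h where h: "bij_betw h {0..<card \<B>} \<B>"
      using ex_bij_betw_nat_finite[OF \<B>(1)] by blast
    (* Each ball B of the cover is replaced by an enlarged ball about a point of the net that contains
       the same points of S. A ball that meets S has its centre within distance 2 of the origin; for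
       any other ball an arbitrary point of the net will do. *)
    have "\<exists>c\<in>C. \<forall>x\<in>S. B \<in> \<B> \<longrightarrow> z x \<in> B \<longrightarrow> edist n c x \<le> 1 / 2 + \<eta>" for B
    proof (cases "\<exists>x\<in>S. B \<in> \<B> \<and> z x \<in> B")
      case True
      then obtain x where x: "x \<in> S" "B \<in> \<B>" "z x \<in> B" by blast
      then obtain b where b: "b \<in> topspace (Euclidean_space n)" "B = ecball n b (1 / 2)"
        using \<B>(3) by (auto simp: is_ball_of_diameter_def)
      have B: "edist n b y \<le> 1 / 2" if "z y \<in> B" for y
        using that b by (simp add: ecball_eq z2)
      have "edist n (\<lambda>_. 0) b \<le> 1 / sqrt 3 + 1 / 2"
        using edist_triangle[of n "\<lambda>_. 0" b x] B[OF x(3)] S(3) x(1) edist_commute[of n b x]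
        by (auto simp: X_def vball_def)
      also have "\<dots> \<le> 2"
      proof -
        have "1 / sqrt 3 \<le> 1" by simp
        then show ?thesis by linarith
      qed
      finally obtain c where c: "c \<in> C" "edist n c b \<le> \<eta>"
        using net by blast
      have "edist n c y \<le> 1 / 2 + \<eta>" if "z y \<in> B" for y
        using B[OF that] c(2) edist_triangle[of n c y b] by linarith
      with c(1) show ?thesis by blast
    qed (use C in blast)
    then have "\<forall>B. \<exists>c. c \<in> C \<and> (\<forall>x\<in>S. B \<in> \<B> \<longrightarrow> z x \<in> B \<longrightarrow> edist n c x \<le> 1 / 2 + \<eta>)"
      by blast
    from choice[OF this] obtain g where g: "\<And>B. g B \<in> C"
      "\<And>B x. x \<in> S \<Longrightarrow> B \<in> \<B> \<Longrightarrow> z x \<in> B \<Longrightarrow> edist n (g B) x \<le> 1 / 2 + \<eta>"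
      by blast
    define F where "F = restrict (\<lambda>j. g (h j)) {..<m}"
    have "F \<in> I" using g(1) by (auto simp: F_def I_def)
    moreover have "S \<subseteq> U F"
    proof
      fix x assume x: "x \<in> S"
      then obtain B where B: "B \<in> \<B>" "z x \<in> B" using \<B>(4) by blast
      then obtain j where j: "j < card \<B>" "h j = B"
        using bij_betw_imp_surj_on[OF h] by (metis atLeastLessThan_iff imageE)
      have "x \<in> space (Leb n)" using S(3) x by (auto simp: X_def vball_def)
      moreover have "j < m" using j(1) \<B>(2) by simp
      moreover have "edist n (F j) x \<le> 1 / 2 + \<eta>"
        using g(2)[OF x B] \<open>j < m\<close> j(2) by (simp add: F_def)
      ultimately show "x \<in> U F"
        unfolding U_def vball_def by blast
    qed
    ultimately show False using no_cover by blast
  qed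
  then show ?thesis
    using S(1) top diam by blast
qed

lemma coverable_by_balls_floor:
  "coverable_by_balls n d M S \<Longrightarrow> coverable_by_balls n d (real (nat \<lfloor>M\<rfloor>)) S"
  unfolding coverable_by_balls_def
  by (elim ex_forward conj_forward) (assumption | rule of_nat_mono[OF le_nat_floor])+

text \<open>
  Take \<open>m = \<lfloor>b^n\<rfloor>\<close> balls with \<open>b = 2/\<surd>3 - \<delta>\<close>. With \<open>\<eta> = \<delta>/4\<close> the fraction of volume that they
  cover is at most \<open>q^n\<close>, where \<open>q = b \<surd>3 (1/2 + \<eta>)\<close> is at most \<open>1 + \<delta>/2 - \<surd>3 \<delta>/2 < 1\<close>. After
  \<open>k m\<close> greedy steps the number of candidate covers that survive is at most the \<open>m\<close>-th power of
  \<open>(2 q^n)^k K^n = 2^k (q^k K)^n\<close>, which tends to \<open>0\<close> once \<open>k\<close> is so large that \<open>q^k K < 1\<close>. The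
  bound on \<open>\<delta>\<close> ensures \<open>b \<ge> 1\<close>, hence \<open>m \<ge> 1\<close>.
\<close>

lemma eventually_diameter_one_set_hard_to_cover:
  fixes \<delta> :: real
  assumes \<delta>: "0 < \<delta>" "\<delta> \<le> 1 / 10"
  shows "\<forall>\<^sub>F n in sequentially. \<exists>S. finite S \<and> S \<subseteq> topspace (Euclidean_space n) \<and>
    ediameter n S = 1 \<and> \<not> coverable_by_balls n 1 ((2 / sqrt 3 - \<delta>) ^ n) S"
proof -
  define b where "b = 2 / sqrt 3 - \<delta>"
  define \<eta> where "\<eta> = \<delta> / 4"
  define r where "r = sqrt 3 * (1 / 2 + \<eta>)"
  define K where "K = (4 + \<eta>) / \<eta>"
  define q where "q = b * r"
  have s3: "sqrt 3 < 20 / 11" "3 / 2 < sqrt 3"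
    by (rule real_less_lsqrt; simp add: power2_eq_square)
      (rule real_less_rsqrt; simp add: power2_eq_square)
  have b: "1 \<le> b"
  proof -
    have "11 / 10 \<le> 2 / sqrt 3" using s3 by (simp add: field_simps)
    then show ?thesis using \<delta> by (simp add: b_def)
  qed
  have r: "0 < r" using \<delta> by (simp add: r_def \<eta>_def add_pos_pos)
  have q0: "0 < q" using b r by (simp add: q_def)
  have "q = 1 + 2 * \<eta> - \<delta> * sqrt 3 / 2 - \<delta> * sqrt 3 * \<eta>"
    by (simp add: q_def b_def r_def field_simps)
  also have "\<dots> < 1"
  proof -
    have "\<delta> * (3 / 2) < \<delta> * sqrt 3" using s3 \<delta> by (intro mult_strict_left_mono)
    moreover have "0 < \<delta> * sqrt 3 * \<eta>" using \<delta> by (simp add: \<eta>_def)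
    moreover have "\<eta> = \<delta> / 4" by (rule \<eta>_def)
    ultimately show ?thesis using \<delta>(1) by linarith
  qed
  finally have q1: "q < 1" .
  have K: "0 < K" using \<delta> by (simp add: K_def \<eta>_def)
  obtain k where k: "q ^ k < 1 / K"
    using real_arch_pow_inv[of "1 / K" q] K q1 by auto
  then have kK: "q ^ k * K < 1" using K by (simp add: field_simps)
  have "(\<lambda>n. 2 ^ k * (q ^ k * K) ^ n) \<longlonglongrightarrow> 2 ^ k * 0"
    using kK q0 K by (intro tendsto_mult tendsto_const LIMSEQ_realpow_zero) auto
  then have ev1: "\<forall>\<^sub>F n in sequentially. 2 ^ k * (q ^ k * K) ^ n < 1"
    by (rule order_tendstoD) simp
  have "(\<lambda>n. real (k + 2) * q ^ n) \<longlonglongrightarrow> real (k + 2) * 0"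
    using q0 q1 by (intro tendsto_mult tendsto_const LIMSEQ_realpow_zero) auto
  then have ev2: "\<forall>\<^sub>F n in sequentially. real (k + 2) * q ^ n < 1 / 2"
    by (rule order_tendstoD) simp
  show ?thesis
    using ev1 ev2 eventually_ge_at_top[of 1]
  proof eventually_elim
    case (elim n)
    define m where "m = nat \<lfloor>b ^ n\<rfloor>"
    have bn: "1 \<le> b ^ n" using b by (rule one_le_power)
    have m: "real m \<le> b ^ n" "1 \<le> m"
      using bn by (auto simp: m_def le_nat_iff le_floor_iff)
    have mp: "real m * r ^ n \<le> q ^ n"
      using m r by (simp add: q_def power_mult_distrib mult_right_mono)
    have "\<exists>S. finite S \<and> S \<subseteq> topspace (Euclidean_space n) \<and> ediameter n S = 1 \<and>
      \<not> coverable_by_balls n 1 (real m) S"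
    proof (rule diameter_one_set_not_coverable)
      show "1 \<le> n" by fact
      show "0 < \<eta>" using \<delta> by (simp add: \<eta>_def)
      have "real (k * m + 2) \<le> real (k + 2) * real m"
        using m(2) by (simp add: algebra_simps)
      then have "real (k * m + 2) * r ^ n \<le> (real (k + 2) * real m) * r ^ n"
        using r by (intro mult_right_mono) auto
      also have "\<dots> = real (k + 2) * (real m * r ^ n)" by simp
      also have "\<dots> \<le> real (k + 2) * q ^ n"
        using mp by (intro mult_left_mono) auto
      finally show "real (k * m + 2) * (sqrt 3 * (1 / 2 + \<eta>)) ^ n \<le> 1 / 2"
        using elim by (simp add: r_def)
      have "(2 * (real m * r ^ n)) ^ (k * m) * (K ^ n) ^ m = ((2 * (real m * r ^ n)) ^ k * K ^ n) ^ m"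
        by (simp add: power_mult_distrib power_mult)
      also have "\<dots> \<le> ((2 * q ^ n) ^ k * K ^ n) ^ m"
        using mp r K q0 by (intro power_mono mult_mono) auto
      also have "(2 * q ^ n) ^ k * K ^ n = 2 ^ k * (q ^ k * K) ^ n"
        by (simp add: power_mult_distrib power_mult[symmetric] mult.commute)
      also have "(2 ^ k * (q ^ k * K) ^ n) ^ m < 1"
        using elim m q0 K by (intro power_less_one_iff[THEN iffD2]) auto
      finally show "(2 * (real m * (sqrt 3 * (1 / 2 + \<eta>)) ^ n)) ^ (k * m) * (((4 + \<eta>) / \<eta>) ^ n) ^ m < 1"
        by (simp add: r_def K_def)
    qed
    then show ?case
      using coverable_by_balls_floor[of n 1 "b ^ n"] unfolding m_def b_def by blast
  qed
qed

section \<open>A single error term\<close>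

text \<open>
  For each \<open>n\<close> take the largest index \<open>j \<le> n\<close> with \<open>Q n (e j)\<close>. Each index \<open>j\<close> for which
  \<open>Q n (e j)\<close> holds for all large \<open>n\<close> is eventually a lower bound of this choice, so the chosen index
  tends to infinity. The index \<open>0\<close>, always possible, takes care of small \<open>n\<close>.
\<close>

lemma tendsto_diagonal_choice:
  fixes e :: "nat \<Rightarrow> real"
  assumes e: "e \<longlonglongrightarrow> l"
    and zero: "\<And>n. N0 \<le> n \<Longrightarrow> Q n (e 0)"
    and ev: "\<forall>\<^sub>F j in sequentially. \<forall>\<^sub>F n in sequentially. Q n (e j)"
  shows "\<exists>\<epsilon>. \<epsilon> \<longlonglongrightarrow> l \<and> (\<forall>n\<ge>N0. Q n (\<epsilon> n))"
proof -
  define J where "J n = {j. j \<le> n \<and> (j = 0 \<or> Q n (e j))}" for n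
  have J: "finite (J n)" "0 \<in> J n" for n by (auto simp: J_def)
  have "filterlim (\<lambda>n. Max (J n)) at_top sequentially"
    unfolding filterlim_at_top
  proof
    fix i
    obtain j where j: "i \<le> j" "\<forall>\<^sub>F n in sequentially. Q n (e j)"
      using eventually_happens'[OF sequentially_bot eventually_conj[OF ev eventually_ge_at_top[of i]]]
      by auto
    show "\<forall>\<^sub>F n in sequentially. i \<le> Max (J n)"
      using j(2) eventually_ge_at_top[of j]
    proof eventually_elim
      case (elim n)
      then have "j \<in> J n" by (simp add: J_def)
      with J show ?case by (intro order_trans[OF j(1) Max_ge]) auto
    qed
  qed
  then have "(\<lambda>n. e (Max (J n))) \<longlonglongrightarrow> l"
    by (rule filterlim_compose[OF e])
  moreover have "Q n (e (Max (J n)))" if "N0 \<le> n" for n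
  proof -
    have "Max (J n) \<in> J n" using J[of n] by (intro Max_in) auto
    then have "Max (J n) = 0 \<or> Q n (e (Max (J n)))" unfolding J_def by blast
    then show ?thesis using zero[OF that] by metis
  qed
  ultimately show ?thesis by blast
qed

lemma not_coverable_by_zero_balls: "S \<noteq> {} \<Longrightarrow> \<not> coverable_by_balls n d 0 S"
  by (auto simp: coverable_by_balls_def)

theorem theorem2:
  shows "\<exists>\<epsilon> :: nat \<Rightarrow> real. \<epsilon> \<longlonglongrightarrow> 0 \<and>
    (\<forall>n\<ge>1. \<exists>S. finite S \<and> S \<subseteq> topspace (Euclidean_space n) \<and> ediameter n S = 1 \<and>
      \<not> coverable_by_balls n 1 ((2 / sqrt 3 - \<epsilon> n) ^ n) S)"
proof -
  define hard where "hard n \<delta> \<longleftrightarrow> (\<exists>S. finite S \<and> S \<subseteq> topspace (Euclidean_space n) \<and>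
    ediameter n S = 1 \<and> \<not> coverable_by_balls n 1 ((2 / sqrt 3 - \<delta>) ^ n) S)" for n and \<delta> :: real
  (* e 0 is the value at which the number of balls becomes 0, so that any set of diameter 1 will do *)
  define e where "e j = (2 / sqrt 3) / real (Suc j)" for j
  have lim: "e \<longlonglongrightarrow> 0"
    unfolding e_def by (rule LIMSEQ_Suc[OF lim_const_over_n])
  have "\<forall>\<^sub>F j in sequentially. e j < 1 / 10"
    using lim by (rule order_tendstoD) simp
  then have large: "\<forall>\<^sub>F j in sequentially. \<forall>\<^sub>F n in sequentially. hard n (e j)"
  proof eventually_elim
    case (elim j)
    have "0 < e j" by (simp add: e_def)
    with elim show ?case
      unfolding hard_def by (intro eventually_diameter_one_set_hard_to_cover) auto
  qed
  have small: "hard n (e 0)" if n: "1 \<le> n" for n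
  proof -
    define a b :: "nat \<Rightarrow> real" where "a = (\<lambda>_. 0)" and "b = (\<lambda>i. if i = 0 then 1 else 0)"
    have "(edist n a b)\<^sup>2 = (\<Sum>i<n. if i = 0 then 1 else 0)"
      unfolding edist_power2 by (intro sum.cong) (auto simp: a_def b_def)
    also have "\<dots> = 1" using n by simp
    finally have d: "edist n a b = 1"
      using edist_nonneg[of n a b] by (simp add: power2_eq_1_iff)
    have "ediameter n {a, b} = 1"
    proof (rule ediameter_eqI)
      show "edist n x y \<le> 1" if "x \<in> {a, b}" "y \<in> {a, b}" for x y
        using that d edist_commute[of n b a] by (auto simp: edist_self)
    qed (use d in auto)
    moreover have "{a, b} \<subseteq> topspace (Euclidean_space n)"
      using n by (auto simp: mem_topspace_Euclidean_space a_def b_def)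
    moreover have "(2 / sqrt 3 - e 0) ^ n = 0"
      using n by (simp add: e_def)
    then have "\<not> coverable_by_balls n 1 ((2 / sqrt 3 - e 0) ^ n) {a, b}"
      by (simp only: not_coverable_by_zero_balls insert_not_empty not_False_eq_True)
    ultimately show ?thesis
      unfolding hard_def by (intro exI[of _ "{a, b}"] conjI finite.intros)
  qed
  show ?thesis
    using tendsto_diagonal_choice[where Q = hard, OF lim small large] by (simp only: hard_def)
qed

end
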